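(* Let $S$ be a commutative semiring and let $I$ be a $g$-closed ideal of $S$ satisfying the maximal-ideal lifting hypothesis. Then the maps $P\mapsto\pi_I(P)$ and $Q\mapsto\pi_I^{-1}(Q)$ are mutually inverse homeomorphisms $\mathrm{Spec}_z^I(S)\cong\mathrm{Spec}_z(S_I)$, where $S_I=S/\wp_I$.
   Context: A semiring here is commutative with $0$ and $1$: $(S,+,0)$ and $(S,\cdot,1)$ are commutative monoids, multiplication distributes over addition, and $0s=0$. An ideal is a non-empty subset closed under addition and under multiplication by arbitrary elements; prime and maximal ideals are proper. $\mathrm{Max}(S)$ is the set of maximal ideals and $\mathcal M(a)=\{M\in\mathrm{Max}(S)\mid a\in M\}$. An ideal $K$ of a semiring is a $z$-ideal if $a\in K$ and $\mathcal M(a)=\mathcal M(b)$ imply $b\in K$ (hulls taken in that semiring). $\mathrm{Spec}_z(R)$ is the set of prime $z$-ideals of a semiring $R$, with closed sets $\{P\mid A\subseteq P\}$, $A\subseteq R$. A congruence is an equivalence relation on $S$ compatible with $+$ and $\cdot$; maximal congruences are maximal among proper ones (those $\neq S\times S$). The zero-class of $\theta$ is $0_\theta=\{a\mid(a,0)\in\theta\}$. For an ideal $I$, $\wp_I$ is the intersection of all maximal congruences $\theta$ with $I\subseteq 0_\theta$ (equal to $S\times S$ if there are none), $I^g=0_{\wp_I}$, and $I$ is $g$-closed if $I=I^g$. Let $\pi_I:S\to S_I:=S/\wp_I$ be the quotient homomorphism and $[a]_I=\pi_I(a)$. An ideal $J$ of $S$ is $I$-saturated if $I^g\subseteq J$ and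 $(a,b)\in\wp_I$ together with $a\in J$ imply $b\in J$; equivalently $J=\pi_I^{-1}(\pi_I(J))$. Put $\mathcal V_{\max}(I)=\{M\in\mathrm{Max}(S)\mid I\subseteq M\}$. A $g$-closed ideal $I$ satisfies the maximal-ideal lifting hypothesis if every maximal ideal of $S_I$ is of the form $\pi_I(M)$ for a unique $M\in\mathcal V_{\max}(I)$, and membership is detected by $[a]_I\in\pi_I(M)\Leftrightarrow a\in M$ for all $a\in S$ and all $M\in\mathcal V_{\max}(I)$. An ideal $J$ of $S$ is an $I$-relative $z$-ideal if $a\in J$, $b\in S$ and $\mathcal M(a)\cap\mathcal V_{\max}(I)=\mathcal M(b)\cap\mathcal V_{\max}(I)$ imply $b\in J$. $\mathrm{Spec}_z^I(S)$ is the set of ideals $P$ of $S$ that are $I$-saturated, $I$-relative $z$-ideals, and ordinary prime ideals; it is topologized by the closed subbasis $V_I(A)=\{P\in\mathrm{Spec}_z^I(S)\mid A\subseteq P\}$, $A\subseteq S$. *)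

theory Defs
  imports "HOL-Algebra.Ring" "HOL-Analysis.Abstract_Topology"
begin

text \<open>
  The library's \<^locale>\<open>semiring\<close> has 0 and 1, with 0 absorbing, and does not require 0 to differ
  from 1.  A commutative semiring is a \<^locale>\<open>semiring\<close> which is also a \<^locale>\<open>comm_monoid\<close> (with
  respect to multiplication).  The library's ideals live in rings (they are additive subgroups),
  so ideals of semirings are defined here.
\<close>

definition semiring_ideal :: "('a, 'b) ring_scheme \<Rightarrow> 'a set \<Rightarrow> bool" where
  "semiring_ideal S J \<longleftrightarrow>
     J \<noteq> {} \<and> J \<subseteq> carrier S \<and>
     (\<forall>a\<in>J. \<forall>b\<in>J. a \<oplus>\<^bsub>S\<^esub> b \<in> J) \<and>
     (\<forall>s\<in>carrier S. \<forall>a\<in>J. s \<otimes>\<^bsub>S\<^esub> a \<in> J)"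

definition semiring_prime_ideal :: "('a, 'b) ring_scheme \<Rightarrow> 'a set \<Rightarrow> bool" where
  "semiring_prime_ideal S P \<longleftrightarrow>
     semiring_ideal S P \<and> P \<noteq> carrier S \<and>
     (\<forall>a\<in>carrier S. \<forall>b\<in>carrier S. a \<otimes>\<^bsub>S\<^esub> b \<in> P \<longrightarrow> a \<in> P \<or> b \<in> P)"

definition Max_ideals :: "('a, 'b) ring_scheme \<Rightarrow> 'a set set" where
  "Max_ideals S =
     {M. semiring_ideal S M \<and> M \<noteq> carrier S \<and>
         (\<forall>J. semiring_ideal S J \<and> M \<subseteq> J \<and> J \<noteq> carrier S \<longrightarrow> J = M)}"

definition max_hull :: "('a, 'b) ring_scheme \<Rightarrow> 'a \<Rightarrow> 'a set set" where
  "max_hull S a = {M \<in> Max_ideals S. a \<in> M}"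

definition z_ideal :: "('a, 'b) ring_scheme \<Rightarrow> 'a set \<Rightarrow> bool" where
  "z_ideal S K \<longleftrightarrow>
     semiring_ideal S K \<and>
     (\<forall>a\<in>K. \<forall>b\<in>carrier S. max_hull S a = max_hull S b \<longrightarrow> b \<in> K)"

definition Spec_z :: "('a, 'b) ring_scheme \<Rightarrow> 'a set set" where
  "Spec_z R = {P. semiring_prime_ideal R P \<and> z_ideal R P}"

text \<open>
  The topology on \<^term>\<open>Spec_z R\<close> whose closed sets are exactly the sets of all points containing
  a given subset of \<open>R\<close>; see \<open>closedin_Spec_z_topology\<close> below.
\<close>

definition Spec_z_topology :: "('a, 'b) ring_scheme \<Rightarrow> 'a set topology" where
  "Spec_z_topology R =
     topology (\<lambda>U. \<exists>A\<subseteq>carrier R. U = Spec_z R - {P \<in> Spec_z R. A \<subseteq> P})"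

definition semiring_congruence :: "('a, 'b) ring_scheme \<Rightarrow> ('a \<times> 'a) set \<Rightarrow> bool" where
  "semiring_congruence S \<theta> \<longleftrightarrow>
     equiv (carrier S) \<theta> \<and>
     (\<forall>a b c d. (a, b) \<in> \<theta> \<and> (c, d) \<in> \<theta> \<longrightarrow>
        (a \<oplus>\<^bsub>S\<^esub> c, b \<oplus>\<^bsub>S\<^esub> d) \<in> \<theta> \<and> (a \<otimes>\<^bsub>S\<^esub> c, b \<otimes>\<^bsub>S\<^esub> d) \<in> \<theta>)"

definition maximal_congruence :: "('a, 'b) ring_scheme \<Rightarrow> ('a \<times> 'a) set \<Rightarrow> bool" where
  "maximal_congruence S \<theta> \<longleftrightarrow>
     semiring_congruence S \<theta> \<and> \<theta> \<noteq> carrier S \<times> carrier S \<and>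
     (\<forall>\<psi>. semiring_congruence S \<psi> \<and> \<theta> \<subseteq> \<psi> \<and> \<psi> \<noteq> carrier S \<times> carrier S \<longrightarrow> \<psi> = \<theta>)"

definition zero_class :: "('a, 'b) ring_scheme \<Rightarrow> ('a \<times> 'a) set \<Rightarrow> 'a set" where
  "zero_class S \<theta> = {a. (a, \<zero>\<^bsub>S\<^esub>) \<in> \<theta>}"

text \<open>
  Intersecting with \<^term>\<open>carrier S \<times> carrier S\<close> makes the empty intersection the total congruence.
\<close>

definition wp_cong :: "('a, 'b) ring_scheme \<Rightarrow> 'a set \<Rightarrow> ('a \<times> 'a) set" where
  "wp_cong S I =
     (carrier S \<times> carrier S) \<inter> \<Inter>{\<theta>. maximal_congruence S \<theta> \<and> I \<subseteq> zero_class S \<theta>}"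

definition g_closure :: "('a, 'b) ring_scheme \<Rightarrow> 'a set \<Rightarrow> 'a set" where
  "g_closure S I = zero_class S (wp_cong S I)"

definition g_closed :: "('a, 'b) ring_scheme \<Rightarrow> 'a set \<Rightarrow> bool" where
  "g_closed S I \<longleftrightarrow> I = g_closure S I"

text \<open>
  The quotient of \<open>S\<close> by a congruence.  The unions collapse to the single class of the sum
  (respectively product) of any two representatives.
\<close>

definition cong_quotient :: "('a, 'b) ring_scheme \<Rightarrow> ('a \<times> 'a) set \<Rightarrow> 'a set ring" where
  "cong_quotient S \<theta> =
     \<lparr>carrier = carrier S // \<theta>,
      mult = (\<lambda>X Y. \<Union>a\<in>X. \<Union>b\<in>Y. \<theta> `` {a \<otimes>\<^bsub>S\<^esub> b}),
      one = \<theta> `` {\<one>\<^bsub>S\<^esub>},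
      zero = \<theta> `` {\<zero>\<^bsub>S\<^esub>},
      add = (\<lambda>X Y. \<Union>a\<in>X. \<Union>b\<in>Y. \<theta> `` {a \<oplus>\<^bsub>S\<^esub> b})\<rparr>"

definition g_quotient :: "('a, 'b) ring_scheme \<Rightarrow> 'a set \<Rightarrow> 'a set ring" where
  "g_quotient S I = cong_quotient S (wp_cong S I)"

definition g_proj :: "('a, 'b) ring_scheme \<Rightarrow> 'a set \<Rightarrow> 'a \<Rightarrow> 'a set" where
  "g_proj S I a = wp_cong S I `` {a}"

definition saturated_ideal :: "('a, 'b) ring_scheme \<Rightarrow> 'a set \<Rightarrow> 'a set \<Rightarrow> bool" where
  "saturated_ideal S I J \<longleftrightarrow>
     semiring_ideal S J \<and> g_closure S I \<subseteq> J \<and>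
     (\<forall>a b. (a, b) \<in> wp_cong S I \<and> a \<in> J \<longrightarrow> b \<in> J)"

definition V_max :: "('a, 'b) ring_scheme \<Rightarrow> 'a set \<Rightarrow> 'a set set" where
  "V_max S I = {M \<in> Max_ideals S. I \<subseteq> M}"

definition max_ideal_lifting :: "('a, 'b) ring_scheme \<Rightarrow> 'a set \<Rightarrow> bool" where
  "max_ideal_lifting S I \<longleftrightarrow>
     (\<forall>N\<in>Max_ideals (g_quotient S I). \<exists>!M. M \<in> V_max S I \<and> N = g_proj S I ` M) \<and>
     (\<forall>a\<in>carrier S. \<forall>M\<in>V_max S I. g_proj S I a \<in> g_proj S I ` M \<longleftrightarrow> a \<in> M)"

definition relative_z_ideal :: "('a, 'b) ring_scheme \<Rightarrow> 'a set \<Rightarrow> 'a set \<Rightarrow> bool" where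
  "relative_z_ideal S I J \<longleftrightarrow>
     semiring_ideal S J \<and>
     (\<forall>a\<in>J. \<forall>b\<in>carrier S.
        max_hull S a \<inter> V_max S I = max_hull S b \<inter> V_max S I \<longrightarrow> b \<in> J)"

definition Spec_z_rel :: "('a, 'b) ring_scheme \<Rightarrow> 'a set \<Rightarrow> 'a set set" where
  "Spec_z_rel S I =
     {P. saturated_ideal S I P \<and> relative_z_ideal S I P \<and> semiring_prime_ideal S P}"

definition V_rel :: "('a, 'b) ring_scheme \<Rightarrow> 'a set \<Rightarrow> 'a set \<Rightarrow> 'a set set" where
  "V_rel S I A = {P \<in> Spec_z_rel S I. A \<subseteq> P}"

text \<open>
  The closed subbasis is given through its complements, an open subbasis.
\<close>

definition Spec_z_rel_topology :: "('a, 'b) ring_scheme \<Rightarrow> 'a set \<Rightarrow> 'a set topology" where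
  "Spec_z_rel_topology S I =
     topology_generated_by {Spec_z_rel S I - V_rel S I A | A. A \<subseteq> carrier S}"

text \<open>The two topologies have the intended points and closed sets.\<close>

lemma prime_ideal_facts:
  assumes "semiring_prime_ideal R P"
  shows "P \<subseteq> carrier R" "\<not> carrier R \<subseteq> P"
  using assms by (auto simp: semiring_prime_ideal_def semiring_ideal_def)

lemma topspace_Spec_z_rel_topology: "topspace (Spec_z_rel_topology S I) = Spec_z_rel S I"
proof -
  have "V_rel S I (carrier S) = {}"
    by (auto simp: V_rel_def Spec_z_rel_def dest: prime_ideal_facts)
  then have "Spec_z_rel S I \<in> {Spec_z_rel S I - V_rel S I A | A. A \<subseteq> carrier S}"
    by (intro CollectI exI[of _ "carrier S"]) simp
  then show ?thesis
    unfolding Spec_z_rel_topology_def topology_generated_by_topspace by blast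
qed

lemma istopology_Spec_z:
  assumes "semiring R" "comm_monoid R"
  shows "istopology (\<lambda>U. \<exists>A\<subseteq>carrier R. U = Spec_z R - {P \<in> Spec_z R. A \<subseteq> P})"
    (is "istopology ?L")
  unfolding istopology_def
proof (intro conjI allI impI)
  interpret semiring R by fact
  interpret comm_monoid R by fact
  fix U V assume "?L U" "?L V"
  then obtain A B where A: "A \<subseteq> carrier R" "U = Spec_z R - {P \<in> Spec_z R. A \<subseteq> P}"
    and B: "B \<subseteq> carrier R" "V = Spec_z R - {P \<in> Spec_z R. B \<subseteq> P}" by blast
  let ?C = "{a \<otimes>\<^bsub>R\<^esub> b | a b. a \<in> A \<and> b \<in> B}"
  have "?C \<subseteq> P \<longleftrightarrow> A \<subseteq> P \<or> B \<subseteq> P" if "P \<in> Spec_z R" for P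
  proof
    assume "?C \<subseteq> P"
    show "A \<subseteq> P \<or> B \<subseteq> P"
    proof (rule ccontr)
      assume "\<not> (A \<subseteq> P \<or> B \<subseteq> P)"
      then obtain a b where ab: "a \<in> A" "a \<notin> P" "b \<in> B" "b \<notin> P" by blast
      then have "a \<otimes>\<^bsub>R\<^esub> b \<in> P" using \<open>?C \<subseteq> P\<close> by blast
      moreover have "a \<in> carrier R" "b \<in> carrier R" using ab A B by auto
      ultimately show False
        using that ab by (auto simp: Spec_z_def semiring_prime_ideal_def)
    qed
  next
    have id: "semiring_ideal R P"
      using that by (auto simp: Spec_z_def semiring_prime_ideal_def)
    have l: "a \<otimes>\<^bsub>R\<^esub> b \<in> P" if "a \<in> carrier R" "b \<in> P" for a b
      using id that by (auto simp: semiring_ideal_def)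
    have r: "a \<otimes>\<^bsub>R\<^esub> b \<in> P" if "b \<in> carrier R" "a \<in> P" for a b
    proof -
      have "a \<in> carrier R" using id that by (auto simp: semiring_ideal_def)
      then show ?thesis using l[OF that] that by (simp add: m_comm)
    qed
    assume "A \<subseteq> P \<or> B \<subseteq> P"
    then show "?C \<subseteq> P" using A(1) B(1) l r by blast
  qed
  then have "U \<inter> V = Spec_z R - {P \<in> Spec_z R. ?C \<subseteq> P}"
    unfolding A B by blast
  moreover have "?C \<subseteq> carrier R" using A(1) B(1) by blast
  ultimately show "?L (U \<inter> V)" by (intro exI conjI)
next
  fix \<K> assume K: "\<forall>K\<in>\<K>. ?L K"
  define A where "A K = (SOME A. A \<subseteq> carrier R \<and> K = Spec_z R - {P \<in> Spec_z R. A \<subseteq> P})" for K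
  have A: "A K \<subseteq> carrier R \<and> K = Spec_z R - {P \<in> Spec_z R. A K \<subseteq> P}" if "K \<in> \<K>" for K
    unfolding A_def by (rule someI_ex) (use K that in auto)
  have mem: "P \<in> K \<longleftrightarrow> P \<in> Spec_z R \<and> \<not> A K \<subseteq> P" if "K \<in> \<K>" for K P
    by (subst conjunct2[OF A[OF that]]) auto
  have "\<Union>\<K> = Spec_z R - {P \<in> Spec_z R. (\<Union>K\<in>\<K>. A K) \<subseteq> P}"
  proof (rule Set.set_eqI)
    fix P
    have "P \<in> \<Union>\<K> \<longleftrightarrow> (\<exists>K\<in>\<K>. P \<in> Spec_z R \<and> \<not> A K \<subseteq> P)"
      by (simp add: mem)
    then show "P \<in> \<Union>\<K> \<longleftrightarrow> P \<in> Spec_z R - {P \<in> Spec_z R. (\<Union>K\<in>\<K>. A K) \<subseteq> P}"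
      by auto
  qed
  moreover have "(\<Union>K\<in>\<K>. A K) \<subseteq> carrier R"
    unfolding UN_subset_iff using A by simp
  ultimately show "?L (\<Union>\<K>)" by (intro exI conjI)
qed

lemma openin_Spec_z_topology:
  assumes "semiring R" "comm_monoid R"
  shows "openin (Spec_z_topology R) U \<longleftrightarrow>
    (\<exists>A\<subseteq>carrier R. U = Spec_z R - {P \<in> Spec_z R. A \<subseteq> P})"
  unfolding Spec_z_topology_def topology_inverse'[OF istopology_Spec_z[OF assms]] ..

lemma topspace_Spec_z_topology:
  assumes "semiring R" "comm_monoid R"
  shows "topspace (Spec_z_topology R) = Spec_z R"
proof -
  have "{P \<in> Spec_z R. carrier R \<subseteq> P} = {}"
    by (auto simp: Spec_z_def dest: prime_ideal_facts)
  then have "openin (Spec_z_topology R) (Spec_z R)"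
    unfolding openin_Spec_z_topology[OF assms] by (intro exI[of _ "carrier R"]) auto
  moreover have "U \<subseteq> Spec_z R" if "openin (Spec_z_topology R) U" for U
    using that unfolding openin_Spec_z_topology[OF assms] by auto
  ultimately show ?thesis
    by (metis openin_subset openin_topspace subset_antisym)
qed

lemma closedin_Spec_z_topology:
  assumes "semiring R" "comm_monoid R"
  shows "closedin (Spec_z_topology R) C \<longleftrightarrow>
    (\<exists>A\<subseteq>carrier R. C = {P \<in> Spec_z R. A \<subseteq> P})"
proof -
  have *: "C \<subseteq> X \<and> X - C = X - D \<longleftrightarrow> C = D" if "D \<subseteq> X" for X D
    using that by blast
  have "closedin (Spec_z_topology R) C \<longleftrightarrow>
      (\<exists>A\<subseteq>carrier R. C \<subseteq> Spec_z R \<and> Spec_z R - C = Spec_z R - {P \<in> Spec_z R. A \<subseteq> P})"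
    unfolding closedin_def topspace_Spec_z_topology[OF assms] openin_Spec_z_topology[OF assms]
    by blast
  also have "\<dots> \<longleftrightarrow> (\<exists>A\<subseteq>carrier R. C = {P \<in> Spec_z R. A \<subseteq> P})"
    by (subst *[OF Collect_restrict]) (rule refl)
  finally show ?thesis .
qed

end

theory Submission
  imports Defs
begin

text \<open>
  Membership detection makes every maximal ideal above \<open>I\<close> saturated, so its image in the quotient is
  again maximal; together with the lifting hypothesis this identifies the maximal ideals of the
  quotient with \<open>V_max S I\<close>.  Equality of hulls in the quotient is therefore equality of hulls
  relative to \<open>I\<close>, and the correspondence between saturated ideals and ideals of the quotient
  matches the two spectra and their closed sets.
\<close>

section \<open>Quotients of commutative semirings and transfer of ideals\<close>

locale comm_semiring_congruence = semiring S + comm_monoid S for S (structure) +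
  fixes \<theta> :: "('a \<times> 'a) set"
  assumes congruence: "semiring_congruence S \<theta>"
begin

abbreviation proj :: "'a \<Rightarrow> 'a set" where
  "proj a \<equiv> \<theta> `` {a}"

abbreviation pullback :: "'a set set \<Rightarrow> 'a set" where
  "pullback Q \<equiv> {a \<in> carrier S. proj a \<in> Q}"

abbreviation S\<theta> :: "'a set ring" where
  "S\<theta> \<equiv> cong_quotient S \<theta>"

lemma equiv: "equiv (carrier S) \<theta>"
  using congruence by (simp add: semiring_congruence_def)

lemma congruence_add: "(a, b) \<in> \<theta> \<Longrightarrow> (c, d) \<in> \<theta> \<Longrightarrow> (a \<oplus> c, b \<oplus> d) \<in> \<theta>"
  and congruence_mult: "(a, b) \<in> \<theta> \<Longrightarrow> (c, d) \<in> \<theta> \<Longrightarrow> (a \<otimes> c, b \<otimes> d) \<in> \<theta>"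
  using congruence by (auto simp: semiring_congruence_def)

lemma proj_eq_iff:
  "a \<in> carrier S \<Longrightarrow> b \<in> carrier S \<Longrightarrow> proj a = proj b \<longleftrightarrow> (a, b) \<in> \<theta>"
  by (rule eq_equiv_class_iff[OF equiv])

lemma carrier_quotient: "carrier S\<theta> = proj ` carrier S"
  by (auto simp: cong_quotient_def quotient_def)

lemma proj_carrier [simp]: "a \<in> carrier S \<Longrightarrow> proj a \<in> carrier S\<theta>"
  by (simp add: carrier_quotient)

lemma zero_quotient: "\<zero>\<^bsub>S\<theta>\<^esub> = proj \<zero>"
  and one_quotient: "\<one>\<^bsub>S\<theta>\<^esub> = proj \<one>"
  by (simp_all add: cong_quotient_def)

lemma proj_add:
  assumes "a \<in> carrier S" "b \<in> carrier S"
  shows "proj a \<oplus>\<^bsub>S\<theta>\<^esub> proj b = proj (a \<oplus> b)"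
proof -
  have "congruent2 \<theta> \<theta> (\<lambda>x y. proj (x \<oplus> y))"
    by (rule congruent2I') (rule equiv_class_eq[OF equiv congruence_add])
  from UN_equiv_class2[OF equiv equiv this assms] show ?thesis
    by (simp add: cong_quotient_def)
qed

lemma proj_mult:
  assumes "a \<in> carrier S" "b \<in> carrier S"
  shows "proj a \<otimes>\<^bsub>S\<theta>\<^esub> proj b = proj (a \<otimes> b)"
proof -
  have "congruent2 \<theta> \<theta> (\<lambda>x y. proj (x \<otimes> y))"
    by (rule congruent2I') (rule equiv_class_eq[OF equiv congruence_mult])
  from UN_equiv_class2[OF equiv equiv this assms] show ?thesis
    by (simp add: cong_quotient_def)
qed

lemma semiring_quotient: "semiring S\<theta>"
proof (rule semiring.intro)
  show "abelian_monoid S\<theta>"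
    by (rule abelian_monoidI)
      (auto simp: carrier_quotient proj_add zero_quotient a_ac)
  show "Group.monoid S\<theta>"
    by (rule Group.monoidI)
      (auto simp: carrier_quotient proj_mult one_quotient m_assoc)
  show "semiring_axioms S\<theta>"
    by (rule semiring_axioms.intro)
      (auto simp: carrier_quotient proj_add proj_mult zero_quotient l_distr r_distr)
qed

lemma comm_monoid_quotient: "comm_monoid S\<theta>"
  by (rule comm_monoidI)
    (auto simp: carrier_quotient proj_mult one_quotient m_ac)

lemma ideal_image:
  assumes "semiring_ideal S J"
  shows "semiring_ideal S\<theta> (proj ` J)"
proof -
  have J: "J \<noteq> {}" "J \<subseteq> carrier S" "\<And>a b. a \<in> J \<Longrightarrow> b \<in> J \<Longrightarrow> a \<oplus> b \<in> J"
    "\<And>s a. s \<in> carrier S \<Longrightarrow> a \<in> J \<Longrightarrow> s \<otimes> a \<in> J"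
    using assms by (auto simp: semiring_ideal_def)
  then have "a \<in> carrier S" if "a \<in> J" for a using that by blast
  with J show ?thesis
    by (auto simp: semiring_ideal_def carrier_quotient proj_add proj_mult)
qed

lemma ideal_pullback:
  assumes "semiring_ideal S\<theta> Q"
  shows "semiring_ideal S (pullback Q)"
proof -
  have Q: "Q \<noteq> {}" "Q \<subseteq> proj ` carrier S" "\<And>a b. a \<in> Q \<Longrightarrow> b \<in> Q \<Longrightarrow> a \<oplus>\<^bsub>S\<theta>\<^esub> b \<in> Q"
    "\<And>s a. s \<in> carrier S\<theta> \<Longrightarrow> a \<in> Q \<Longrightarrow> s \<otimes>\<^bsub>S\<theta>\<^esub> a \<in> Q"
    using assms by (auto simp: semiring_ideal_def carrier_quotient)
  have "pullback Q \<noteq> {}" using Q(1,2) by blast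
  then show ?thesis
    \<comment> \<open>The flipped rules split the class of a sum or product into an operation on
      classes, to which closure of \<open>Q\<close> applies.\<close>
    using Q(3,4) by (auto simp: semiring_ideal_def simp flip: proj_add proj_mult)
qed

text \<open>Surjectivity of \<open>proj\<close> onto the quotient suffices: each class in
  \<open>Q\<close> has a representative, which then lies in the pullback.\<close>

lemma image_pullback:
  assumes "semiring_ideal S\<theta> Q"
  shows "proj ` pullback Q = Q"
  using assms by (auto simp: semiring_ideal_def carrier_quotient)

lemma proper_pullback:
  assumes "semiring_ideal S\<theta> Q" "Q \<noteq> carrier S\<theta>"
  shows "pullback Q \<noteq> carrier S"
  using image_pullback[OF assms(1)] assms(2) by (metis carrier_quotient)

text \<open>Ideals are only required to be non-empty, so zero comes from absorption, as zero times
  some member.\<close>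

lemma zero_in_ideal:
  assumes "semiring_ideal S J"
  shows "\<zero> \<in> J"
proof -
  obtain a where a: "a \<in> J" "a \<in> carrier S" using assms by (auto simp: semiring_ideal_def)
  then have "\<zero> \<otimes> a \<in> J" using assms unfolding semiring_ideal_def by blast
  then show ?thesis using a by simp
qed

text \<open>A class in the image has some representative in \<open>J\<close>; saturation passes
  membership on to every other representative.\<close>

lemma proj_in_image_iff:
  assumes "J \<subseteq> carrier S" "\<And>a b. (a, b) \<in> \<theta> \<Longrightarrow> a \<in> J \<Longrightarrow> b \<in> J" "a \<in> carrier S"
  shows "proj a \<in> proj ` J \<longleftrightarrow> a \<in> J"
proof
  assume "proj a \<in> proj ` J"
  then obtain b where "b \<in> J" "proj a = proj b" by blast
  then have "(b, a) \<in> \<theta>" using proj_eq_iff[of b a] assms by auto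
  then show "a \<in> J" using assms(2) \<open>b \<in> J\<close> by blast
qed auto

text \<open>The condition \<open>mem\<close> takes the place of saturation. It sends an element
  outside \<open>P\<close> to a class outside the image, giving properness, and lifts a product in
  the image to a product in \<open>P\<close>.\<close>

lemma prime_image:
  assumes prime: "semiring_prime_ideal S P"
    and mem: "\<And>a. a \<in> carrier S \<Longrightarrow> proj a \<in> proj ` P \<longleftrightarrow> a \<in> P"
  shows "semiring_prime_ideal S\<theta> (proj ` P)"
proof -
  obtain x where "x \<in> carrier S" "x \<notin> P" using prime_ideal_facts(2)[OF prime] by blast
  then have "proj x \<in> carrier S\<theta>" "proj x \<notin> proj ` P" using mem by auto
  then have "proj ` P \<noteq> carrier S\<theta>" by blast
  moreover have "semiring_ideal S\<theta> (proj ` P)"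
    using prime ideal_image by (simp add: semiring_prime_ideal_def)
  moreover have "proj a \<in> proj ` P \<or> proj b \<in> proj ` P"
    if "a \<in> carrier S" "b \<in> carrier S" "proj a \<otimes>\<^bsub>S\<theta>\<^esub> proj b \<in> proj ` P" for a b
  proof -
    have "a \<otimes> b \<in> P" using that mem by (simp only: proj_mult m_closed)
    then have "a \<in> P \<or> b \<in> P" using that prime by (auto simp: semiring_prime_ideal_def)
    then show ?thesis by blast
  qed
  ultimately show ?thesis
    unfolding semiring_prime_ideal_def by (auto simp only: carrier_quotient)
qed

lemma prime_pullback:
  assumes "semiring_prime_ideal S\<theta> Q"
  shows "semiring_prime_ideal S (pullback Q)"
proof -
  have Q: "semiring_ideal S\<theta> Q" "Q \<noteq> carrier S\<theta>"
    "\<And>X Y. X \<in> carrier S\<theta> \<Longrightarrow> Y \<in> carrier S\<theta> \<Longrightarrow> X \<otimes>\<^bsub>S\<theta>\<^esub> Y \<in> Q \<Longrightarrow> X \<in> Q \<or> Y \<in> Q"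
    using assms by (auto simp: semiring_prime_ideal_def)
  then show ?thesis
    using ideal_pullback proper_pullback
    by (auto simp: semiring_prime_ideal_def simp flip: proj_mult)
qed

text \<open>A proper ideal above the image pulls back to a proper ideal above \<open>M\<close>,
  hence to \<open>M\<close> itself, and is recovered as the image of its pullback. Properness of the
  image comes from \<open>mem\<close>.\<close>

lemma maximal_image:
  assumes max: "M \<in> Max_ideals S"
    and mem: "\<And>a. a \<in> carrier S \<Longrightarrow> proj a \<in> proj ` M \<longleftrightarrow> a \<in> M"
  shows "proj ` M \<in> Max_ideals S\<theta>"
proof -
  have M: "semiring_ideal S M" "M \<noteq> carrier S" "M \<subseteq> carrier S"
    "\<And>J. semiring_ideal S J \<Longrightarrow> M \<subseteq> J \<Longrightarrow> J \<noteq> carrier S \<Longrightarrow> J = M"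
    using max by (auto simp: Max_ideals_def semiring_ideal_def)
  obtain x where "x \<in> carrier S" "x \<notin> M" using M(2,3) by blast
  then have "proj x \<in> carrier S\<theta>" "proj x \<notin> proj ` M" using mem by auto
  then have "proj ` M \<noteq> carrier S\<theta>" by blast
  moreover have "J = proj ` M"
    if J: "semiring_ideal S\<theta> J" "proj ` M \<subseteq> J" "J \<noteq> carrier S\<theta>" for J
  proof -
    have "M \<subseteq> pullback J" using J(2) M(3) by auto
    then have "pullback J = M"
      by (intro M(4) ideal_pullback proper_pullback J)
    then show ?thesis using image_pullback[OF J(1)] by simp
  qed
  ultimately show ?thesis using ideal_image[OF M(1)] by (auto simp: Max_ideals_def)
qed

end

section \<open>The congruence defining the quotient\<close>

text \<open>Congruences are stable under intersection; closure of the carrier under both operations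
  handles the factor \<open>carrier S \<times> carrier S\<close>, and with it an empty
  family.\<close>

lemma wp_cong_congruence:
  assumes "semiring S"
  shows "semiring_congruence S (wp_cong S I)"
proof -
  interpret semiring S by fact
  have max: "semiring_congruence S \<theta>" if "maximal_congruence S \<theta>" for \<theta>
    using that by (simp add: maximal_congruence_def)
  have eq: "equiv (carrier S) \<theta>" if "maximal_congruence S \<theta>" for \<theta>
    using max[OF that] by (simp add: semiring_congruence_def)
  have "equiv (carrier S) (wp_cong S I)"
  proof (rule equivI)
    show "wp_cong S I \<subseteq> carrier S \<times> carrier S" by (auto simp: wp_cong_def)
    show "refl_on (carrier S) (wp_cong S I)"
      using eq by (auto simp: wp_cong_def refl_on_def equiv_def)
    show "sym (wp_cong S I)"
      using eq by (auto simp: wp_cong_def sym_def equiv_def)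
    show "trans (wp_cong S I)"
      using eq unfolding wp_cong_def trans_def equiv_def by blast
  qed
  then show ?thesis
    using max unfolding semiring_congruence_def wp_cong_def
    by (auto 0 4)
qed

section \<open>Maximal ideals and hulls under the lifting hypothesis\<close>

locale lifting_ideal = semiring S + comm_monoid S for S (structure) +
  fixes I :: "'a set"
  assumes lifting: "max_ideal_lifting S I"
begin

sublocale comm_semiring_congruence S "wp_cong S I"
  by unfold_locales (rule wp_cong_congruence, unfold_locales)

lemma g_proj_eq: "g_proj S I = proj"
  by (simp add: fun_eq_iff g_proj_def)

lemma proj_in_max_iff:
  "M \<in> V_max S I \<Longrightarrow> a \<in> carrier S \<Longrightarrow> proj a \<in> proj ` M \<longleftrightarrow> a \<in> M"
  using lifting by (auto simp: max_ideal_lifting_def g_proj_eq)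

text \<open>The lifting hypothesis gives one inclusion; the other is \<open>maximal_image\<close>,
  whose condition \<open>mem\<close> is membership detection.\<close>

lemma Max_ideals_quotient: "Max_ideals S\<theta> = (\<lambda>M. proj ` M) ` V_max S I"
proof (intro equalityI subsetI)
  fix N assume "N \<in> Max_ideals S\<theta>"
  then have "\<exists>M. M \<in> V_max S I \<and> N = proj ` M"
    using lifting unfolding max_ideal_lifting_def g_proj_eq g_quotient_def
    by metis
  then show "N \<in> (\<lambda>M. proj ` M) ` V_max S I" by blast
next
  fix N assume "N \<in> (\<lambda>M. proj ` M) ` V_max S I"
  then obtain M where "M \<in> V_max S I" "N = proj ` M" by blast
  then show "N \<in> Max_ideals S\<theta>"
    using maximal_image[of M] proj_in_max_iff by (auto simp: V_max_def)
qed

text \<open>Translates the z-ideal condition of the quotient into the relative one: hulls agree when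
  the same maximal ideals contain both elements, and those of the quotient are images of members of
  \<open>V_max S I\<close> with membership detected.\<close>

lemma max_hull_quotient_eq_iff:
  assumes "a \<in> carrier S" "b \<in> carrier S"
  shows "max_hull S\<theta> (proj a) = max_hull S\<theta> (proj b) \<longleftrightarrow>
    max_hull S a \<inter> V_max S I = max_hull S b \<inter> V_max S I" (is "?L \<longleftrightarrow> ?R")
proof -
  have "?L \<longleftrightarrow> (\<forall>N \<in> Max_ideals S\<theta>. proj a \<in> N \<longleftrightarrow> proj b \<in> N)"
    by (auto simp: max_hull_def)
  also have "\<dots> \<longleftrightarrow> (\<forall>M \<in> V_max S I. a \<in> M \<longleftrightarrow> b \<in> M)"
    unfolding Max_ideals_quotient using assms by (simp add: proj_in_max_iff)
  also have "\<dots> \<longleftrightarrow> ?R"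
    by (auto simp: max_hull_def V_max_def)
  finally show ?thesis .
qed

section \<open>The bijection between the two spectra\<close>

lemma point_subset: "P \<in> Spec_z_rel S I \<Longrightarrow> P \<subseteq> carrier S"
  by (auto simp: Spec_z_rel_def dest: prime_ideal_facts)

lemma proj_in_point_iff:
  assumes "P \<in> Spec_z_rel S I" "a \<in> carrier S"
  shows "proj a \<in> proj ` P \<longleftrightarrow> a \<in> P"
proof (rule proj_in_image_iff)
  show "P \<subseteq> carrier S" using assms(1) by (rule point_subset)
  show "b \<in> P" if "(a, b) \<in> wp_cong S I" "a \<in> P" for a b
    using assms that by (auto simp: Spec_z_rel_def saturated_ideal_def)
qed fact

lemma image_in_Spec_z:
  assumes P: "P \<in> Spec_z_rel S I"
  shows "proj ` P \<in> Spec_z S\<theta>"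
proof -
  have prime: "semiring_prime_ideal S\<theta> (proj ` P)"
    using P by (intro prime_image proj_in_point_iff) (auto simp: Spec_z_rel_def)
  \<comment> \<open>The z-ideal condition is checked on representatives, since every class has the
    form \<open>proj b\<close>.\<close>
  have "proj b \<in> proj ` P"
    if "a \<in> P" "b \<in> carrier S" "max_hull S\<theta> (proj a) = max_hull S\<theta> (proj b)" for a b
  proof -
    have "a \<in> carrier S" using P that(1) point_subset by blast
    then have "b \<in> P"
      using that P by (auto simp: max_hull_quotient_eq_iff Spec_z_rel_def relative_z_ideal_def)
    then show ?thesis by blast
  qed
  then have "z_ideal S\<theta> (proj ` P)"
    using prime unfolding z_ideal_def semiring_prime_ideal_def
    by (auto simp only: carrier_quotient)
  then show ?thesis using prime by (simp add: Spec_z_def)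
qed

lemma pullback_in_Spec_z_rel:
  assumes "Q \<in> Spec_z S\<theta>"
  shows "pullback Q \<in> Spec_z_rel S I"
proof -
  have Q: "semiring_prime_ideal S\<theta> Q" "semiring_ideal S\<theta> Q"
    "\<And>X Y. X \<in> Q \<Longrightarrow> Y \<in> carrier S\<theta> \<Longrightarrow> max_hull S\<theta> X = max_hull S\<theta> Y \<Longrightarrow> Y \<in> Q"
    using assms by (auto simp: Spec_z_def z_ideal_def)
  have ideal: "semiring_ideal S (pullback Q)" by (rule ideal_pullback) fact
  have sat: "b \<in> pullback Q" if "(a, b) \<in> wp_cong S I" "a \<in> pullback Q" for a b
  proof -
    have "b \<in> carrier S" using that(1) by (simp add: wp_cong_def)
    moreover have "proj a = proj b" by (rule equiv_class_eq[OF equiv that(1)])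
    ultimately show ?thesis using that(2) by simp
  qed
  \<comment> \<open>Elements of the closure are congruent to zero, which lies in every ideal, so
    \<open>sat\<close> applies.\<close>
  have "a \<in> pullback Q" if "a \<in> g_closure S I" for a
  proof (rule sat)
    show "(\<zero>, a) \<in> wp_cong S I"
      using that equiv by (auto simp: g_closure_def zero_class_def equiv_def sym_def)
  qed (rule zero_in_ideal[OF ideal])
  then have "saturated_ideal S I (pullback Q)"
    using ideal sat unfolding saturated_ideal_def by blast
  moreover have "relative_z_ideal S I (pullback Q)"
    unfolding relative_z_ideal_def
  proof (intro conjI ballI impI ideal)
    fix a b
    assume "a \<in> pullback Q" "b \<in> carrier S"
      "max_hull S a \<inter> V_max S I = max_hull S b \<inter> V_max S I"
    then show "b \<in> pullback Q"
      using Q(3)[of "proj a" "proj b"] by (simp add: max_hull_quotient_eq_iff)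
  qed
  ultimately show ?thesis
    using prime_pullback[OF Q(1)] by (simp add: Spec_z_rel_def)
qed

lemma pullback_image: "P \<in> Spec_z_rel S I \<Longrightarrow> pullback (proj ` P) = P"
  using point_subset[of P] proj_in_point_iff[of P] by blast

section \<open>Continuity in both directions\<close>

text \<open>The preimage of the closed set given by \<open>A\<close> is
  \<open>V_rel S I (pullback A)\<close>, so preimages of open sets are already members of the
  generating family.\<close>

lemma continuous_image:
  "continuous_map (Spec_z_rel_topology S I) (Spec_z_topology S\<theta>) (\<lambda>P. proj ` P)"
  unfolding continuous_map topspace_Spec_z_rel_topology
    topspace_Spec_z_topology[OF semiring_quotient comm_monoid_quotient]
proof (intro conjI allI impI)
  fix U assume "openin (Spec_z_topology S\<theta>) U"
  then obtain A where A: "A \<subseteq> carrier S\<theta>" "U = Spec_z S\<theta> - {Q \<in> Spec_z S\<theta>. A \<subseteq> Q}"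
    unfolding openin_Spec_z_topology[OF semiring_quotient comm_monoid_quotient] by blast
  have sub: "A \<subseteq> proj ` P \<longleftrightarrow> pullback A \<subseteq> P" if "P \<in> Spec_z_rel S I" for P
  proof
    assume "A \<subseteq> proj ` P"
    then show "pullback A \<subseteq> P" using proj_in_point_iff[OF that] by auto
  next
    assume "pullback A \<subseteq> P"
    show "A \<subseteq> proj ` P"
    proof
      fix X assume "X \<in> A"
      \<comment> \<open>A representative of \<open>X\<close> lies in \<open>pullback A\<close>,
        hence in \<open>P\<close>.\<close>
      then obtain a where "X = proj a" "a \<in> carrier S" using A(1) carrier_quotient by auto
      then show "X \<in> proj ` P" using \<open>X \<in> A\<close> \<open>pullback A \<subseteq> P\<close> by auto
    qed
  qed
  have "{P \<in> Spec_z_rel S I. proj ` P \<in> U} = Spec_z_rel S I - V_rel S I (pullback A)"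
    unfolding A(2) V_rel_def using image_in_Spec_z sub by auto
  moreover have "pullback A \<subseteq> carrier S" by blast
  ultimately show "openin (Spec_z_rel_topology S I) {P \<in> Spec_z_rel S I. proj ` P \<in> U}"
    unfolding Spec_z_rel_topology_def by (intro topology_generated_by_Basis CollectI exI conjI)
qed (use image_in_Spec_z in auto)

lemma continuous_pullback:
  "continuous_map (Spec_z_topology S\<theta>) (Spec_z_rel_topology S I) pullback"
  unfolding Spec_z_rel_topology_def
proof (rule continuous_on_generated_topo)
  note top = topspace_Spec_z_topology[OF semiring_quotient comm_monoid_quotient]
  fix U assume "U \<in> {Spec_z_rel S I - V_rel S I A | A. A \<subseteq> carrier S}"
  then obtain A where A: "A \<subseteq> carrier S" "U = Spec_z_rel S I - V_rel S I A" by blast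
  have "pullback -` U \<inter> topspace (Spec_z_topology S\<theta>) =
      Spec_z S\<theta> - {Q \<in> Spec_z S\<theta>. proj ` A \<subseteq> Q}"
    using pullback_in_Spec_z_rel A(1) by (auto simp: A(2) V_rel_def top)
  moreover have "proj ` A \<subseteq> carrier S\<theta>" using A(1) by auto
  ultimately show "openin (Spec_z_topology S\<theta>) (pullback -` U \<inter> topspace (Spec_z_topology S\<theta>))"
    unfolding openin_Spec_z_topology[OF semiring_quotient comm_monoid_quotient] by blast
next
  \<comment> \<open>The rule also asks that the generators cover the range; their union is the whole
    space of points.\<close>
  have "pullback ` topspace (Spec_z_topology S\<theta>) \<subseteq> topspace (Spec_z_rel_topology S I)"
    using pullback_in_Spec_z_rel
    by (auto simp: topspace_Spec_z_rel_topology
        topspace_Spec_z_topology[OF semiring_quotient comm_monoid_quotient])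
  then show "pullback ` topspace (Spec_z_topology S\<theta>)
      \<subseteq> \<Union> {Spec_z_rel S I - V_rel S I A | A. A \<subseteq> carrier S}"
    by (simp add: Spec_z_rel_topology_def topology_generated_by_topspace)
qed

end

theorem theorem7p2:
  fixes S :: "('a, 'b) ring_scheme" and I :: "'a set"
  assumes "semiring S" and "comm_monoid S"
    and "semiring_ideal S I" and "g_closed S I"
    and "max_ideal_lifting S I"
  shows "homeomorphic_maps (Spec_z_rel_topology S I) (Spec_z_topology (g_quotient S I))
           (\<lambda>P. g_proj S I ` P) (\<lambda>Q. {a \<in> carrier S. g_proj S I a \<in> Q})"
proof -
  interpret semiring S by fact
  interpret comm_monoid S by fact
  interpret lifting_ideal S I by unfold_locales fact
  have "proj ` pullback Q = Q" if "Q \<in> Spec_z S\<theta>" for Q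
    using that by (intro image_pullback) (simp add: Spec_z_def semiring_prime_ideal_def)
  then show ?thesis
    unfolding homeomorphic_maps_def g_quotient_def g_proj_eq topspace_Spec_z_rel_topology
      topspace_Spec_z_topology[OF semiring_quotient comm_monoid_quotient]
    by (simp add: continuous_image continuous_pullback pullback_image)
qed

end
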